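(* Let $\beta<1/(2e)$ and $\varepsilon\le\ln 2$, and let $\mathcal{M}\colon\mathcal{X}_L^n\to\mathcal{R}$ be a $(\beta,\varepsilon,\delta)$-perfectly generalizing mechanism. Let $\mathcal{M}'(\mathcal{M},\cdot)$ be the mechanism which, on input $S_L\in\mathcal{X}_L^n$, lets $\mathcal{E}_{S_L}$ be the empirical distribution assigning weight $1/n$ to each data point of $S_L$, samples $T_L\sim_{i.i.d.}(\mathcal{E}_{S_L})^n$, and outputs $\mathcal{M}(T_L)$. Then $\mathcal{M}'(\mathcal{M},\cdot)$ is $(4\varepsilon,16\delta+2\beta)$-differentially private.
   Context: $\mathcal{X}_L=\mathcal{X}\times\{0,1\}$. Distributions $\mathcal{J}_1,\mathcal{J}_2$ over $\mathcal{R}$ are $(\varepsilon,\delta)$-close, $\mathcal{J}_1\approx_{\varepsilon,\delta}\mathcal{J}_2$, if for all $\mathcal{O}\subseteq\mathcal{R}$, $\Pr_{\mathcal{J}_1}[\mathcal{O}]\le e^{\varepsilon}\Pr_{\mathcal{J}_2}[\mathcal{O}]+\delta$ and $\Pr_{\mathcal{J}_2}[\mathcal{O}]\le e^{\varepsilon}\Pr_{\mathcal{J}_1}[\mathcal{O}]+\delta$. A mechanism $\mathcal{M}\colon\mathcal{Y}^n\to\mathcal{R}$ is $(\beta,\varepsilon,\delta)$-perfectly generalizing if for every distribution $\mathcal{C}$ over $\mathcal{Y}$ there exists a distribution (simulator) $\mathrm{Sim}_{\mathcal{C}}$ over $\mathcal{R}$ such that with probability at least $1-\beta$ over $T\sim_{i.i.d.}\mathcal{C}^n$,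 $\mathcal{M}(T)\approx_{\varepsilon,\delta}\mathrm{Sim}_{\mathcal{C}}$. Samples $T,T'\in\mathcal{Y}^n$ are neighboring if they differ in exactly one element; $\mathcal{M}$ is $(\varepsilon,\delta)$-differentially private if $\mathcal{M}(T)\approx_{\varepsilon,\delta}\mathcal{M}(T')$ for every pair of neighboring $T,T'$. *)

theory Defs
  imports "HOL-Probability.Probability"
begin

text \<open>
  Conventions: data domains and output ranges are measurable spaces, given by a measure of which
  only the space and the \<open>\<sigma>\<close>-algebra are used; the events are its measurable sets, so that with
  \<^term>\<open>count_space UNIV\<close> every subset of the range is an event. The distributions over \<open>Y\<close> are the
  elements of \<^term>\<open>space (prob_algebra Y)\<close>.
\<close>

text \<open>The samples in \<open>Y\<^sup>n\<close> are the extensional functions on \<open>{..<n}\<close>.\<close>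

abbreviation sample_space :: "nat \<Rightarrow> 'y measure \<Rightarrow> (nat \<Rightarrow> 'y) measure" where
  "sample_space n Y \<equiv> Pi\<^sub>M {..<n} (\<lambda>_. Y)"

text \<open>A randomized mechanism \<open>Y\<^sup>n \<rightarrow> R\<close> is a Markov kernel.\<close>

abbreviation mechanisms :: "nat \<Rightarrow> 'y measure \<Rightarrow> 'r measure \<Rightarrow> ((nat \<Rightarrow> 'y) \<Rightarrow> 'r measure) set" where
  "mechanisms n Y R \<equiv> sample_space n Y \<rightarrow>\<^sub>M prob_algebra R"

abbreviation labeled :: "'x measure \<Rightarrow> ('x \<times> nat) measure" where
  "labeled X \<equiv> X \<Otimes>\<^sub>M count_space {0, 1}"

definition dist_close ::
  "'r measure \<Rightarrow> real \<Rightarrow> real \<Rightarrow> 'r measure \<Rightarrow> 'r measure \<Rightarrow> bool" where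
  "dist_close R \<epsilon> \<delta> J1 J2 \<longleftrightarrow>
     (\<forall>A\<in>sets R. measure J1 A \<le> exp \<epsilon> * measure J2 A + \<delta> \<and>
                 measure J2 A \<le> exp \<epsilon> * measure J1 A + \<delta>)"

text \<open>
  The set of samples \<open>T\<close> for which \<open>M T\<close> is close to the simulator need not be measurable when the
  \<open>\<sigma>\<close>-algebra of \<open>R\<close> is not countably generated. That it has probability at least \<open>1 - \<beta>\<close> is taken
  to mean that it contains a measurable event \<open>E\<close> of probability at least \<open>1 - \<beta>\<close>.
\<close>

definition perfectly_generalizing ::
  "nat \<Rightarrow> 'y measure \<Rightarrow> 'r measure \<Rightarrow> real \<Rightarrow> real \<Rightarrow> real \<Rightarrow>
     ((nat \<Rightarrow> 'y) \<Rightarrow> 'r measure) \<Rightarrow> bool" where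
  "perfectly_generalizing n Y R \<beta> \<epsilon> \<delta> M \<longleftrightarrow>
     (\<forall>C\<in>space (prob_algebra Y). \<exists>Sim\<in>space (prob_algebra R).
        \<exists>E\<in>sets (sample_space n C).
          measure (sample_space n C) E \<ge> 1 - \<beta> \<and>
          (\<forall>T\<in>E. dist_close R \<epsilon> \<delta> (M T) Sim))"

definition neighboring :: "nat \<Rightarrow> (nat \<Rightarrow> 'y) \<Rightarrow> (nat \<Rightarrow> 'y) \<Rightarrow> bool" where
  "neighboring n T T' \<longleftrightarrow> (\<exists>!i. i < n \<and> T i \<noteq> T' i)"

definition differentially_private ::
  "nat \<Rightarrow> 'y measure \<Rightarrow> 'r measure \<Rightarrow> real \<Rightarrow> real \<Rightarrow>
     ((nat \<Rightarrow> 'y) \<Rightarrow> 'r measure) \<Rightarrow> bool" where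
  "differentially_private n Y R \<epsilon> \<delta> M \<longleftrightarrow>
     (\<forall>T\<in>space (sample_space n Y). \<forall>T'\<in>space (sample_space n Y).
        neighboring n T T' \<longrightarrow> dist_close R \<epsilon> \<delta> (M T) (M T'))"

text \<open>
  The law of \<open>S i\<close> for a uniformly random index \<open>i < n\<close>: each entry of \<open>S\<close> has weight \<open>1/n\<close>, and
  repeated entries accumulate their weights. It is a distribution only for \<open>n > 0\<close>; for \<open>n = 0\<close>
  there are no neighboring samples.
\<close>

definition empirical :: "nat \<Rightarrow> 'y measure \<Rightarrow> (nat \<Rightarrow> 'y) \<Rightarrow> 'y measure" where
  "empirical n Y S = distr (uniform_count_measure {..<n}) Y S"

lemma measure_empirical:
  assumes "S \<in> space (sample_space n Y)" "A \<in> sets Y"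
  shows "measure (empirical n Y S) A = card {i. i < n \<and> S i \<in> A} / n"
proof -
  have m: "S \<in> uniform_count_measure {..<n} \<rightarrow>\<^sub>M Y"
    using assms(1)
    by (auto simp: measurable_def space_PiM space_uniform_count_measure
        sets_uniform_count_measure)
  have "measure (empirical n Y S) A
      = measure (uniform_count_measure {..<n}) {i. i < n \<and> S i \<in> A}"
    unfolding empirical_def measure_distr[OF m assms(2)]
    by (rule arg_cong[where f = "measure _"]) (auto simp: space_uniform_count_measure)
  also have "\<dots> = card {i. i < n \<and> S i \<in> A} / n"
    by (subst measure_uniform_count_measure) auto
  finally show ?thesis .
qed

definition resample ::
  "nat \<Rightarrow> 'y measure \<Rightarrow> ((nat \<Rightarrow> 'y) \<Rightarrow> 'r measure) \<Rightarrow> (nat \<Rightarrow> 'y) \<Rightarrow> 'r measure" where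
  "resample n Y M S = sample_space n (empirical n Y S) \<bind> M"

lemma empirical_prob_algebra:
  assumes "S \<in> space (sample_space n Y)" "n > 0"
  shows "empirical n Y S \<in> space (prob_algebra Y)"
proof -
  have "S \<in> uniform_count_measure {..<n} \<rightarrow>\<^sub>M Y"
    using assms(1)
    by (auto simp: measurable_def space_PiM space_uniform_count_measure
        sets_uniform_count_measure)
  moreover have "prob_space (uniform_count_measure {..<n})"
    using assms(2) by (intro prob_space_uniform_count_measure) auto
  ultimately show ?thesis
    by (auto simp: space_prob_algebra empirical_def intro: prob_space.prob_space_distr)
qed

lemma resample_prob_algebra:
  assumes "S \<in> space (sample_space n Y)" "n > 0" "M \<in> mechanisms n Y R"
  shows "resample n Y M S \<in> space (prob_algebra R)"
proof -
  let ?E = "empirical n Y S"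
  have E: "prob_space ?E" "sets ?E = sets Y"
    using empirical_prob_algebra[OF assms(1,2)] by (auto simp: space_prob_algebra)
  have s: "sets (sample_space n ?E) = sets (sample_space n Y)"
    using E by (intro sets_PiM_cong) auto
  have p: "prob_space (sample_space n ?E)"
    using E by (intro prob_space_PiM) auto
  have "sample_space n ?E \<in> space (prob_algebra (sample_space n Y))"
    using p s by (auto simp: space_prob_algebra)
  then show ?thesis
    using prob_space_bind'[OF _ assms(3)] sets_bind'[OF _ assms(3)]
    by (auto simp: resample_def space_prob_algebra)
qed

end

theory Submission
  imports Defs
begin

text \<open>
  For neighboring \<open>S\<close> and \<open>S'\<close>, let \<open>Q\<close> be the empirical distribution of the \<open>n + 1\<close> points
  obtained by adding to \<open>S\<close> the entry of \<open>S'\<close> in which they differ. The empirical distributions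
  of \<open>S\<close> and \<open>S'\<close> are at most \<open>(1 + 1/n) Q\<close>, so their \<open>n\<close>-fold products are at most
  \<open>(1 + 1/n)\<^sup>n \<le> e\<close> times that of \<open>Q\<close>. As \<open>e \<beta> < 1/2\<close>, the good event \<open>F\<close> of \<open>Q\<close> has probability
  more than \<open>1/2\<close> when resampling from \<open>S\<close>, and hence meets the good event \<open>G\<close> of \<open>S\<close>.
  Let \<open>q\<close> be the probability that the simulator of \<open>Q\<close> gives to an output event. Up to multiples
  of \<open>\<delta>\<close>, the mechanism gives to it a probability within a factor \<open>exp \<epsilon>\<close> of \<open>q\<close> for samples in
  \<open>F\<close>, and, passing through a sample in \<open>F \<inter> G\<close>, within \<open>exp (3 \<epsilon>)\<close> of \<open>q\<close> for samples in \<open>G\<close>.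
  Outside \<open>F \<union> G\<close>, which has probability at most \<open>\<beta>\<close>, it is at most \<open>1\<close>.
  Since \<open>F\<close> has at least half of the mass, the worst case is that both bounds have equal weight;
  the factors in the resulting upper and lower bounds for \<open>S\<close> and \<open>S'\<close> have the ratio
  \<open>(exp \<epsilon> + exp (3 \<epsilon>)) / (exp (-\<epsilon>) + exp (-3 \<epsilon>)) = exp (4 \<epsilon>)\<close>.
\<close>

section \<open>Domination of product measures\<close>

lemma nn_integral_le_scale:
  fixes c :: ennreal
  assumes "sets Q = sets P" "\<And>A. A \<in> sets P \<Longrightarrow> emeasure P A \<le> c * emeasure Q A"
    and "f \<in> borel_measurable Q"
  shows "nn_integral P f \<le> c * nn_integral Q f"
proof -
  have "nn_integral P f \<le> nn_integral (scale_measure c Q) f"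
    using assms(1,2) by (intro nn_integral_mono_measure) (auto simp: le_measure)
  also have "\<dots> = c * nn_integral Q f"
    using assms(3) by (intro nn_integral_scale_measure) 
  finally show ?thesis .
qed

text \<open>Induction on \<open>I\<close>: integrating out one coordinate costs one factor
  \<open>c\<close>. Integrals are used instead of events because the induction hypothesis is applied
  to an inner integral, which is not an indicator.\<close>

lemma nn_integral_PiM_le_scale:
  fixes c :: ennreal
  assumes "finite I" "prob_space P" "prob_space Q"
    and sets: "sets Q = sets P"
    and le: "\<And>A. A \<in> sets P \<Longrightarrow> emeasure P A \<le> c * emeasure Q A"
    and "f \<in> borel_measurable (PiM I (\<lambda>_. Q))"
  shows "nn_integral (PiM I (\<lambda>_. P)) f \<le> c ^ card I * nn_integral (PiM I (\<lambda>_. Q)) f"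
  using assms(1,6)
proof (induction I arbitrary: f rule: finite_induct)
  case empty
  then show ?case by (simp add: PiM_empty nn_integral_count_space_finite)
next
  case (insert i I)
  interpret P: prob_space P by fact
  interpret Q: prob_space Q by fact
  interpret PP: product_sigma_finite "\<lambda>_. P" by standard
  interpret QQ: product_sigma_finite "\<lambda>_. Q" by standard
  have [measurable_cong]: "sets P = sets Q" by (simp add: sets)
  have eq: "sets (PiM J (\<lambda>_. P)) = sets (PiM J (\<lambda>_. Q))" for J
    by (intro sets_PiM_cong) (auto simp: sets)
  note f[measurable] = insert.prems
  have f': "f \<in> borel_measurable (PiM (insert i I) (\<lambda>_. P))"
    using f measurable_cong_sets[OF eq refl] by blast
  have meas: "(\<lambda>x. \<integral>\<^sup>+ y. f (x(i := y)) \<partial>Q) \<in> borel_measurable (PiM I (\<lambda>_. Q))"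
    by measurable
  have "nn_integral (PiM (insert i I) (\<lambda>_. P)) f
      = (\<integral>\<^sup>+ x. (\<integral>\<^sup>+ y. f (x(i := y)) \<partial>P) \<partial>PiM I (\<lambda>_. P))"
    using insert.hyps f' by (intro PP.product_nn_integral_insert)
  also have "\<dots> \<le> (\<integral>\<^sup>+ x. c * (\<integral>\<^sup>+ y. f (x(i := y)) \<partial>Q) \<partial>PiM I (\<lambda>_. P))"
  proof (intro nn_integral_mono nn_integral_le_scale sets le)
    fix x assume "x \<in> space (PiM I (\<lambda>_. P))"
    then have x: "x \<in> space (PiM I (\<lambda>_. Q))"
      using sets_eq_imp_space_eq[OF eq] by blast
    show "(\<lambda>y. f (x(i := y))) \<in> borel_measurable Q"
      using x by measurable
  qed
  also have "\<dots> \<le> c ^ card I * (\<integral>\<^sup>+ x. c * (\<integral>\<^sup>+ y. f (x(i := y)) \<partial>Q) \<partial>PiM I (\<lambda>_. Q))"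
    using meas by (intro insert.IH) measurable
  also have "\<dots> = c ^ card (insert i I) * (\<integral>\<^sup>+ x. (\<integral>\<^sup>+ y. f (x(i := y)) \<partial>Q) \<partial>PiM I (\<lambda>_. Q))"
    using insert.hyps meas by (simp add: nn_integral_cmult ac_simps)
  also have "\<dots> = c ^ card (insert i I) * nn_integral (PiM (insert i I) (\<lambda>_. Q)) f"
    using insert.hyps f by (subst QQ.product_nn_integral_insert) auto
  finally show ?case .
qed

lemma measure_PiM_le_scale:
  assumes "finite I" "prob_space P" "prob_space Q" "sets Q = sets P" "c \<ge> 0"
    and le: "\<And>A. A \<in> sets P \<Longrightarrow> measure P A \<le> c * measure Q A"
    and B: "B \<in> sets (PiM I (\<lambda>_. Q))"
  shows "measure (PiM I (\<lambda>_. P)) B \<le> c ^ card I * measure (PiM I (\<lambda>_. Q)) B"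
proof -
  interpret P: prob_space P by fact
  interpret Q: prob_space Q by fact
  interpret PP: prob_space "PiM I (\<lambda>_. P)" by (intro prob_space_PiM P.prob_space_axioms)
  interpret QQ: prob_space "PiM I (\<lambda>_. Q)" by (intro prob_space_PiM Q.prob_space_axioms)
  have eq: "sets (PiM I (\<lambda>_. P)) = sets (PiM I (\<lambda>_. Q))"
    by (intro sets_PiM_cong) (auto simp: assms(4))
  have "emeasure P A \<le> ennreal c * emeasure Q A" if "A \<in> sets P" for A
    using le[OF that] \<open>c \<ge> 0\<close>
    by (simp add: P.emeasure_eq_measure Q.emeasure_eq_measure flip: ennreal_mult)
  from nn_integral_PiM_le_scale[OF assms(1-4) this, of "indicator B"]
  have "emeasure (PiM I (\<lambda>_. P)) B \<le> ennreal c ^ card I * emeasure (PiM I (\<lambda>_. Q)) B"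
    using B eq by simp
  then show ?thesis
    using \<open>c \<ge> 0\<close>
    by (simp add: PP.emeasure_eq_measure QQ.emeasure_eq_measure ennreal_power flip: ennreal_mult)
qed

section \<open>Resampling as an expectation, and expectations bounded on two events\<close>

lemma measure_resample:
  assumes "S \<in> space (sample_space n Y)" "n > 0" "M \<in> mechanisms n Y R" "A \<in> sets R"
  shows "measure (resample n Y M S) A
    = (\<integral>T. measure (M T) A \<partial>sample_space n (empirical n Y S))"
proof -
  let ?P = "sample_space n (empirical n Y S)"
  have E: "prob_space (empirical n Y S)" "sets (empirical n Y S) = sets Y"
    using empirical_prob_algebra[OF assms(1,2)] by (auto simp: space_prob_algebra)
  have s: "sets ?P = sets (sample_space n Y)"
    using E by (intro sets_PiM_cong) auto
  interpret prob_space ?P using E by (intro prob_space_PiM) auto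
  have "M \<in> sample_space n Y \<rightarrow>\<^sub>M subprob_algebra R"
    using assms(3) by (rule measurable_prob_algebraD)
  then have "M \<in> ?P \<rightarrow>\<^sub>M subprob_algebra R"
    using measurable_cong_sets[OF s refl] by blast
  then show ?thesis
    unfolding resample_def using assms(4) by (intro measure_bind) auto
qed

text \<open>Use \<open>a\<close> on \<open>F\<close>, \<open>b\<close> on \<open>G - F\<close> and 1
  on the rest, of mass \<open>r\<close>. Because \<open>a \<le> b\<close> and \<open>F\<close> has
  at least half of the mass, the worst case splits \<open>1 - r\<close> equally between
  \<open>F\<close> and \<open>G - F\<close>.\<close>

lemma (in prob_space) expectation_le_two_events:
  fixes f :: "'a \<Rightarrow> real"
  assumes f: "f \<in> borel_measurable M" "\<And>x. x \<in> space M \<Longrightarrow> 0 \<le> f x" "\<And>x. x \<in> space M \<Longrightarrow> f x \<le> 1"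
    and F: "F \<in> events" "prob F \<ge> 1 / 2" "\<And>x. x \<in> F \<Longrightarrow> f x \<le> a"
    and G: "G \<in> events" "prob G \<ge> 1 - \<beta>" "\<And>x. x \<in> G \<Longrightarrow> f x \<le> b"
    and "a \<le> b" "\<beta> \<le> 1"
  shows "expectation f \<le> \<beta> + (1 - \<beta>) * ((a + b) / 2)"
proof -
  have int: "integrable M f"
    using f by (intro integrable_const_bound[where B = 1] AE_I2) auto
  show ?thesis
  proof (cases "(a + b) / 2 \<le> 1")
    \<comment> \<open>Here \<open>f \<le> 1\<close> suffices. In the other case the bound increases
      with \<open>r\<close>, so that \<open>r\<close> may be replaced by
      \<open>\<beta>\<close>.\<close>
    case False
    have "expectation f \<le> expectation (\<lambda>_. 1)"
      using int f by (intro integral_mono) auto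
    then have "expectation f - \<beta> \<le> (1 - \<beta>) * 1" by (simp add: prob_space)
    also have "(1 - \<beta>) * 1 \<le> (1 - \<beta>) * ((a + b) / 2)"
      using False \<open>\<beta> \<le> 1\<close> by (intro mult_left_mono) auto
    finally show ?thesis by simp
  next
    case True
    define r where "r = prob (space M - (F \<union> G))"
    have "r \<le> prob (space M - G)"
      unfolding r_def using F G by (intro finite_measure_mono) auto
    then have r: "r \<le> \<beta>" using G by (simp add: prob_compl)
    have "prob (F \<union> G) = prob F + prob (G - F)"
      using F G by (subst finite_measure_Union[symmetric]) auto
    moreover have "r = 1 - prob (F \<union> G)"
      unfolding r_def using F G by (intro prob_compl) auto
    ultimately have GF: "prob (G - F) = 1 - prob F - r" by simp
    have "0 \<le> r" by (simp add: r_def)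
    let ?g = "\<lambda>x. a * indicator F x + b * indicator (G - F) x
                 + 1 * indicator (space M - (F \<union> G)) x :: real"
    have "expectation f \<le> expectation ?g"
    proof (intro integral_mono int)
      show "integrable M ?g" using F G by (auto intro!: integrable_real_indicator simp: emeasure_eq_measure)
      show "f x \<le> ?g x" if "x \<in> space M" for x
        using f(3)[OF that] F(3)[of x] G(3)[of x] that by (auto simp: indicator_def)
    qed
    also have "\<dots> = a * prob F + b * prob (G - F) + r"
      using F G by (simp add: r_def emeasure_eq_measure)
    also have "\<dots> = r + (1 - r) * ((a + b) / 2) - (b - a) * (prob F - (1 - r) / 2)"
      unfolding GF by (simp add: field_simps)
    also have "\<dots> \<le> r + (1 - r) * ((a + b) / 2)"
      using F(2) \<open>0 \<le> r\<close> \<open>a \<le> b\<close> by simp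
    also have "\<dots> = 1 - (1 - r) * (1 - (a + b) / 2)"
      by (simp add: field_simps)
    also have "\<dots> \<le> 1 - (1 - \<beta>) * (1 - (a + b) / 2)"
      using r True by (intro diff_left_mono mult_right_mono) auto
    also have "\<dots> = \<beta> + (1 - \<beta>) * ((a + b) / 2)"
      by (simp add: field_simps)
    finally show ?thesis .
  qed
qed

lemma (in prob_space) expectation_ge_two_events:
  fixes f :: "'a \<Rightarrow> real"
  assumes f: "f \<in> borel_measurable M" "\<And>x. x \<in> space M \<Longrightarrow> 0 \<le> f x" "\<And>x. x \<in> space M \<Longrightarrow> f x \<le> 1"
    and F: "F \<in> events" "prob F \<ge> 1 / 2" "\<And>x. x \<in> F \<Longrightarrow> a \<le> f x"
    and G: "G \<in> events" "prob G \<ge> 1 - \<beta>" "\<And>x. x \<in> G \<Longrightarrow> b \<le> f x"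
    and "b \<le> a" "\<beta> \<le> 1"
  shows "(1 - \<beta>) * ((a + b) / 2) \<le> expectation f"
proof -
  have int: "integrable M f"
    using f by (intro integrable_const_bound[where B = 1] AE_I2) auto
  \<comment> \<open>Passing to \<open>1 - f\<close> reverses the order of the bounds.\<close>
  have "expectation (\<lambda>x. 1 - f x) \<le> \<beta> + (1 - \<beta>) * (((1 - a) + (1 - b)) / 2)"
    using assms by (intro expectation_le_two_events[where F = F and G = G]) auto
  moreover have "expectation (\<lambda>x. 1 - f x) = 1 - expectation f"
    using int by (simp add: prob_space)
  ultimately show ?thesis by (simp add: field_simps)
qed

section \<open>Closeness, empirical distributions, and the bounds for one sample\<close>

lemma dist_close_nonneg:
  assumes "dist_close R \<epsilon> \<delta> J1 J2"
  shows "0 \<le> \<delta>"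
  using assms by (auto simp: dist_close_def dest: bspec[where x = "{}"])

text \<open>Compares the masses of the whole space. For negative \<epsilon> this bounds the loss
  incurred when factors \<open>exp \<epsilon>\<close> are below 1.\<close>

lemma dist_close_ge_one_minus_exp:
  assumes "dist_close R \<epsilon> \<delta> J1 J2" "J1 \<in> space (prob_algebra R)" "J2 \<in> space (prob_algebra R)"
  shows "1 - exp \<epsilon> \<le> \<delta>"
proof -
  have "prob_space J1" "prob_space J2" "space J1 = space R" "space J2 = space R"
    using assms(2,3) by (auto simp: space_prob_algebra dest: sets_eq_imp_space_eq)
  then have "measure J1 (space R) = 1" "measure J2 (space R) = 1"
    using prob_space.prob_space by metis+
  then show ?thesis
    using assms(1) by (auto simp: dist_close_def dest: bspec[where x = "space R"])
qed

lemma measure_empirical_le_scale: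
  assumes S: "S \<in> space (sample_space n Y)" and Z: "Z \<in> space (sample_space m Y)"
    and "n > 0" and g: "inj_on g {..<n}" "g ` {..<n} \<subseteq> {..<m}"
    and eq: "\<And>j. j < n \<Longrightarrow> S j = Z (g j)"
    and A: "A \<in> sets Y"
  shows "measure (empirical n Y S) A \<le> (m / n) * measure (empirical m Y Z) A"
proof -
  have "g 0 < m" using g(2) \<open>n > 0\<close> by auto
  then have "m > 0" by simp
  have "card {j. j < n \<and> S j \<in> A} = card (g ` {j. j < n \<and> S j \<in> A})"
    using g(1) by (intro card_image[symmetric]) (auto intro: inj_on_subset)
  also have "\<dots> \<le> card {j. j < m \<and> Z j \<in> A}"
    using g(2) eq by (intro card_mono) auto
  finally show ?thesis
    using \<open>n > 0\<close> \<open>m > 0\<close>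
    by (simp add: measure_empirical[OF S A] measure_empirical[OF Z A] divide_right_mono)
qed

text \<open>\<open>J\<close> and \<open>F\<close> belong to \<open>Z\<close> alone, so two samples
  embedded in the same \<open>Z\<close> get bounds with the same \<open>q\<close>. Multiplying the
  lower bound by \<open>u ^ 4\<close> turns its factor \<open>1/u + 1/u^3\<close> into the
  \<open>u + u ^ 3\<close> of the upper bound.\<close>

lemma resample_bounds:
  fixes n :: nat and \<beta> \<epsilon> \<delta> :: real
  assumes beta: "\<beta> < 1 / (2 * exp 1)" and eps: "\<epsilon> \<le> ln 2"
    and M: "M \<in> mechanisms n Y R"
    and pg: "perfectly_generalizing n Y R \<beta> \<epsilon> \<delta> M"
    and "n > 0"
    and S: "S \<in> space (sample_space n Y)" and Z: "Z \<in> space (sample_space (Suc n) Y)"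
    and g: "inj_on g {..<n}" "g ` {..<n} \<subseteq> {..<Suc n}" "\<And>j. j < n \<Longrightarrow> S j = Z (g j)"
    and J: "J \<in> space (prob_algebra R)"
    and F: "F \<in> sets (sample_space n (empirical (Suc n) Y Z))"
      "measure (sample_space n (empirical (Suc n) Y Z)) F \<ge> 1 - \<beta>"
      "\<And>T. T \<in> F \<Longrightarrow> dist_close R \<epsilon> \<delta> (M T) J"
    and A: "A \<in> sets R"
  defines "u \<equiv> exp \<epsilon>" and "q \<equiv> measure J A" and "m \<equiv> measure (resample n Y M S) A"
  shows "0 \<le> \<beta>" "0 \<le> \<delta>"
    and "m \<le> \<beta> + (1 - \<beta>) * (((u + u ^ 3) * q + 8 * \<delta>) / 2)"
    and "(1 - \<beta>) * (((u + u ^ 3) * q - 22 * \<delta>) / 2) \<le> u ^ 4 * m"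
proof -
  let ?CS = "empirical n Y S" and ?CZ = "empirical (Suc n) Y Z"
  let ?P = "sample_space n ?CS" and ?Q = "sample_space n ?CZ"
  define f where "f = (\<lambda>T. measure (M T) A)"
  have CS: "?CS \<in> space (prob_algebra Y)"
    using S \<open>n > 0\<close> by (rule empirical_prob_algebra)
  then have CS': "prob_space ?CS" "sets ?CS = sets Y" by (auto simp: space_prob_algebra)
  have "?CZ \<in> space (prob_algebra Y)"
    using Z by (rule empirical_prob_algebra) simp
  then have CZ': "prob_space ?CZ" "sets ?CZ = sets Y" by (auto simp: space_prob_algebra)
  have setsP: "sets ?P = sets (sample_space n Y)" and setsQ: "sets ?Q = sets ?P"
    using CS' CZ' by (auto intro!: sets_PiM_cong)
  interpret P: prob_space ?P using CS' by (intro prob_space_PiM) auto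
  interpret Q: prob_space ?Q using CZ' by (intro prob_space_PiM) auto

  obtain Sim G where Sim: "Sim \<in> space (prob_algebra R)" and G: "G \<in> sets ?P"
    "measure ?P G \<ge> 1 - \<beta>" "\<And>T. T \<in> G \<Longrightarrow> dist_close R \<epsilon> \<delta> (M T) Sim"
    using pg CS unfolding perfectly_generalizing_def by meson
  show "0 \<le> \<beta>" using G(2) P.prob_le_1[of G] by linarith
  have "1 / (2 * exp 1) \<le> (1 / 2 :: real)" by (simp add: field_simps)
  then have "\<beta> < 1 / 2" using beta by linarith

  have FP: "F \<in> P.events" using F(1) setsQ by simp
  have "prob_space.prob ?P (space ?P - F) \<le> (Suc n / n) ^ n * Q.prob (space ?P - F)"
    using measure_PiM_le_scale[of "{..<n}" ?CS ?CZ "Suc n / n" "space ?P - F"]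
      measure_empirical_le_scale[OF S Z \<open>n > 0\<close> g] CS' CZ' FP setsQ
    by auto
  also have "\<dots> \<le> exp 1 * \<beta>"
  proof (intro mult_mono)
    have "Suc n / n = 1 + 1 / n" using \<open>n > 0\<close> by (simp add: field_simps)
    then show "(Suc n / n) ^ n \<le> exp 1"
      using exp_ge_one_plus_x_over_n_power_n[of n 1] \<open>n > 0\<close> by simp
    show "Q.prob (space ?P - F) \<le> \<beta>"
      using Q.prob_compl[OF F(1)] F(2) sets_eq_imp_space_eq[OF setsQ] by simp
  qed auto
  also have "\<dots> < 1 / 2" using beta by (simp add: field_simps)
  finally have PF: "P.prob F > 1 / 2" using P.prob_compl[OF FP] by simp

  have "F \<inter> G \<noteq> {}"
  proof
    assume "F \<inter> G = {}"
    then have "P.prob (F \<union> G) = P.prob F + P.prob G"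
      using FP G by (intro P.finite_measure_Union) auto
    then show False
      using PF G(2) \<open>\<beta> < 1 / 2\<close> P.prob_le_1[of "F \<union> G"] by linarith
  qed
  then obtain T where T: "T \<in> F" "T \<in> G" by blast
  have closeF: "f T' \<le> u * q + \<delta>" "q \<le> u * f T' + \<delta>" if "T' \<in> F" for T'
    using F(3)[OF that] A by (auto simp: dist_close_def f_def q_def u_def)
  define s where "s = measure Sim A"
  have closeG: "f T' \<le> u * s + \<delta>" "s \<le> u * f T' + \<delta>" if "T' \<in> G" for T'
    using G(3)[OF that] A by (auto simp: dist_close_def f_def s_def u_def)

  have "T \<in> space (sample_space n Y)"
    using T(2) G(1) setsP sets.sets_into_space by blast
  then have MT: "M T \<in> space (prob_algebra R)" using M by (rule measurable_space[rotated])
  have d0: "0 \<le> \<delta>" and d1: "1 - u \<le> \<delta>"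
    using dist_close_nonneg[OF F(3)[OF T(1)]] dist_close_ge_one_minus_exp[OF F(3)[OF T(1)] MT J]
    by (auto simp: u_def)
  show "0 \<le> \<delta>" by fact
  have u: "0 < u" "u \<le> 2"
    using eps by (auto simp: u_def simp flip: ln_ge_iff)
  have q: "0 \<le> q" "q \<le> 1"
    using J by (auto simp: q_def space_prob_algebra intro: prob_space.prob_le_1)

  \<comment> \<open>The common sample \<open>T\<close> links the two simulators. Each passage costs
    a factor \<open>u\<close>, and \<open>u \<le> 2\<close> absorbs
    \<open>u * \<delta> + \<delta>\<close> into \<open>3 * \<delta>\<close>.\<close>
  have sq: "s \<le> u ^ 2 * q + 3 * \<delta>"
  proof -
    have "s \<le> u * (u * q + \<delta>) + \<delta>"
      using closeG(2)[OF T(2)] mult_left_mono[OF closeF(1)[OF T(1)], of u] u by linarith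
    also have "\<dots> = u ^ 2 * q + u * \<delta> + \<delta>" by (simp add: power2_eq_square algebra_simps)
    also have "\<dots> \<le> u ^ 2 * q + 3 * \<delta>" using mult_right_mono[OF u(2) d0] by linarith
    finally show ?thesis .
  qed
  have qs: "q \<le> u ^ 2 * s + 3 * \<delta>"
  proof -
    have "q \<le> u * (u * s + \<delta>) + \<delta>"
      using closeF(2)[OF T(1)] mult_left_mono[OF closeG(1)[OF T(2)], of u] u by linarith
    also have "\<dots> = u ^ 2 * s + u * \<delta> + \<delta>" by (simp add: power2_eq_square algebra_simps)
    also have "\<dots> \<le> u ^ 2 * s + 3 * \<delta>" using mult_right_mono[OF u(2) d0] by linarith
    finally show ?thesis .
  qed
  have u2: "u ^ 2 \<le> 4" using power_mono[OF u(2), of 2] u by simp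
  have upG: "f T' \<le> u ^ 3 * q + 7 * \<delta>" if "T' \<in> G" for T'
  proof -
    have "f T' \<le> u * (u ^ 2 * q + 3 * \<delta>) + \<delta>"
      using closeG(1)[OF that] mult_left_mono[OF sq, of u] u by linarith
    also have "\<dots> = u ^ 3 * q + 3 * (u * \<delta>) + \<delta>" by (simp add: power3_eq_cube power2_eq_square algebra_simps)
    also have "\<dots> \<le> u ^ 3 * q + 7 * \<delta>" using mult_right_mono[OF u(2) d0] by linarith
    finally show ?thesis .
  qed
  have lowG: "q - 7 * \<delta> \<le> u ^ 3 * f T'" if "T' \<in> G" for T'
  proof -
    have "q \<le> u ^ 2 * (u * f T' + \<delta>) + 3 * \<delta>"
      using qs mult_left_mono[OF closeG(2)[OF that], of "u ^ 2"] u by (smt (verit) zero_le_power2)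
    also have "\<dots> = u ^ 3 * f T' + u ^ 2 * \<delta> + 3 * \<delta>" by (simp add: power3_eq_cube power2_eq_square algebra_simps)
    finally show ?thesis using mult_right_mono[OF u2 d0] by linarith
  qed

  \<comment> \<open>If \<open>u < 1\<close>, then \<open>u ^ 2 * q\<close> can fall below
    \<open>q\<close>, but by at most \<open>2 * \<delta>\<close>. This keeps the bounds on
    \<open>F\<close> and \<open>G\<close> in the order that the two-event lemmas require.\<close>
  have "1 - u ^ 2 \<le> 2 * \<delta>"
  proof -
    have "(1 - u) ^ 2 \<ge> 0" by simp
    then have "1 - u ^ 2 \<le> 2 * (1 - u)" by (simp add: power2_eq_square algebra_simps)
    also have "\<dots> \<le> 2 * \<delta>" using d1 by simp
    finally show ?thesis .
  qed
  then have "(1 - u ^ 2) * q \<le> (2 * \<delta>) * q" using q by (intro mult_right_mono) auto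
  also have "\<dots> \<le> 2 * \<delta>" using q d0 by (simp add: mult_left_le)
  finally have uq: "q \<le> u ^ 2 * q + 2 * \<delta>" by (simp add: algebra_simps)

  have f: "f \<in> borel_measurable ?P"
  proof -
    have "f \<in> borel_measurable (sample_space n Y)"
      unfolding f_def using A
      by (intro measurable_compose[OF measurable_prob_algebraD[OF M]] measurable_measure_subprob_algebra)
    then show ?thesis using measurable_cong_sets[OF setsP refl] by blast
  qed
  have f01: "0 \<le> f x" "f x \<le> 1" if "x \<in> space ?P" for x
  proof -
    have "x \<in> space (sample_space n Y)" using that sets_eq_imp_space_eq[OF setsP] by simp
    then have "prob_space (M x)"
      using measurable_space[OF M] by (auto simp: space_prob_algebra)
    then show "0 \<le> f x" "f x \<le> 1" by (auto simp: f_def prob_space.prob_le_1)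
  qed
  have m: "m = P.expectation f"
    unfolding m_def f_def using S \<open>n > 0\<close> M A by (rule measure_resample)

  have "u * q + \<delta> \<le> u ^ 3 * q + 7 * \<delta>"
  proof -
    have "u * q \<le> u * (u ^ 2 * q + 2 * \<delta>)" using uq u by (intro mult_left_mono) auto
    also have "\<dots> = u ^ 3 * q + 2 * (u * \<delta>)" by (simp add: power3_eq_cube power2_eq_square algebra_simps)
    finally show ?thesis using mult_right_mono[OF u(2) d0] d0 by linarith
  qed
  then have "m \<le> \<beta> + (1 - \<beta>) * (((u * q + \<delta>) + (u ^ 3 * q + 7 * \<delta>)) / 2)"
    unfolding m using f f01 FP PF G upG closeF \<open>\<beta> < 1 / 2\<close>
    by (intro P.expectation_le_two_events[where F = F and G = G]) auto
  also have "(u * q + \<delta>) + (u ^ 3 * q + 7 * \<delta>) = (u + u ^ 3) * q + 8 * \<delta>"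
    by (simp add: algebra_simps)
  finally show "m \<le> \<beta> + (1 - \<beta>) * (((u + u ^ 3) * q + 8 * \<delta>) / 2)" .

  have "(1 - \<beta>) * (((q - \<delta>) / u + (q - 7 * \<delta>) / u ^ 3) / 2) \<le> m"
    unfolding m
  proof (rule P.expectation_ge_two_events[where F = F and G = G])
    show "(q - \<delta>) / u \<le> f x" if "x \<in> F" for x
      using closeF(2)[OF that] u by (simp add: field_simps)
    show "(q - 7 * \<delta>) / u ^ 3 \<le> f x" if "x \<in> G" for x
      using lowG[OF that] u by (simp add: field_simps)
    have "q - 7 * \<delta> \<le> u ^ 2 * (q - \<delta>)"
      using uq mult_right_mono[OF u2 d0] d0 by (simp add: algebra_simps)
    then have "(q - 7 * \<delta>) / u ^ 3 \<le> u ^ 2 * (q - \<delta>) / u ^ 3"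
      using u by (intro divide_right_mono) auto
    also have "\<dots> = (q - \<delta>) / u"
      using u by (simp add: power3_eq_cube power2_eq_square)
    finally show "(q - 7 * \<delta>) / u ^ 3 \<le> (q - \<delta>) / u" .
  qed (use f f01 FP PF G \<open>\<beta> < 1 / 2\<close> in auto)
  then have "u ^ 4 * ((1 - \<beta>) * (((q - \<delta>) / u + (q - 7 * \<delta>) / u ^ 3) / 2)) \<le> u ^ 4 * m"
    using u by (intro mult_left_mono) auto
  moreover have "u ^ 4 * ((q - \<delta>) / u + (q - 7 * \<delta>) / u ^ 3)
      = (u + u ^ 3) * q - (u ^ 2 * u + 7 * u) * \<delta>"
    using u by (simp add: field_simps eval_nat_numeral)
  \<comment> \<open>From \<open>u \<le> 2\<close>: 22 = 4 * 2 + 7 * 2.\<close>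
  moreover have "(u ^ 2 * u + 7 * u) * \<delta> \<le> 22 * \<delta>"
    using mult_mono[OF u2 u(2)] u d0 by (intro mult_right_mono) auto
  then have "(1 - \<beta>) * (((u + u ^ 3) * q - 22 * \<delta>) / 2)
      \<le> (1 - \<beta>) * (((u + u ^ 3) * q - (u ^ 2 * u + 7 * u) * \<delta>) / 2)"
    using \<open>\<beta> < 1 / 2\<close> by (intro mult_left_mono divide_right_mono diff_left_mono) auto
  ultimately show "(1 - \<beta>) * (((u + u ^ 3) * q - 22 * \<delta>) / 2) \<le> u ^ 4 * m"
    by (simp add: mult.left_commute)
qed

section \<open>Comparison of neighboring samples\<close>

lemma resample_neighboring_le:
  fixes n :: nat and \<beta> \<epsilon> \<delta> :: real
  assumes ass: "\<beta> < 1 / (2 * exp 1)" "\<epsilon> \<le> ln 2" "M \<in> mechanisms n Y R"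
      "perfectly_generalizing n Y R \<beta> \<epsilon> \<delta> M"
    and S: "S \<in> space (sample_space n Y)" and S': "S' \<in> space (sample_space n Y)"
    and "neighboring n S S'" and A: "A \<in> sets R"
  shows "measure (resample n Y M S) A
    \<le> exp (4 * \<epsilon>) * measure (resample n Y M S') A + (16 * \<delta> + 2 * \<beta>)"
proof -
  obtain i where i: "i < n" "\<And>j. j < n \<Longrightarrow> j \<noteq> i \<Longrightarrow> S j = S' j"
    using \<open>neighboring n S S'\<close> by (auto simp: neighboring_def)
  then have "n > 0" by simp
  \<comment> \<open>The new entry sits at index \<open>n\<close>, just past those of
    \<open>S\<close>. So \<open>S\<close> embeds by the identity, and \<open>S'\<close> by sending
    \<open>i\<close> to \<open>n\<close>.\<close>
  define Z where "Z = S(n := S' i)"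
  have Z: "Z \<in> space (sample_space (Suc n) Y)"
    using S S' i(1) by (auto simp: Z_def space_PiM PiE_def Pi_def extensional_def less_Suc_eq)
  then have "empirical (Suc n) Y Z \<in> space (prob_algebra Y)"
    by (rule empirical_prob_algebra) simp
  then obtain J F where J: "J \<in> space (prob_algebra R)"
    and F: "F \<in> sets (sample_space n (empirical (Suc n) Y Z))"
      "measure (sample_space n (empirical (Suc n) Y Z)) F \<ge> 1 - \<beta>"
      "\<And>T. T \<in> F \<Longrightarrow> dist_close R \<epsilon> \<delta> (M T) J"
    using ass(4) unfolding perfectly_generalizing_def by meson
  define u q where "u = exp \<epsilon>" and "q = measure J A"
  note bounds = resample_bounds[OF ass \<open>n > 0\<close> _ Z _ _ _ J F A, folded u_def q_def]
  have g: "inj_on (\<lambda>j. j) {..<n}" "(\<lambda>j. j) ` {..<n} \<subseteq> {..<Suc n}"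
    "\<And>j. j < n \<Longrightarrow> S j = Z j"
    by (auto simp: Z_def)
  let ?h = "\<lambda>j. if j = i then n else j"
  have h: "inj_on ?h {..<n}" "?h ` {..<n} \<subseteq> {..<Suc n}"
    "\<And>j. j < n \<Longrightarrow> S' j = Z (?h j)"
    using i by (auto simp: Z_def inj_on_def)
  note nonneg = bounds(1,2)[OF S g]
  have "u ^ 4 = exp (4 * \<epsilon>)" by (simp add: u_def flip: exp_of_nat_mult)
  then have "(1 - \<beta>) * (((u + u ^ 3) * q - 22 * \<delta>) / 2)
      \<le> exp (4 * \<epsilon>) * measure (resample n Y M S') A"
    using bounds(4)[OF S' h] by simp
  moreover have "measure (resample n Y M S) A
      \<le> \<beta> + (1 - \<beta>) * (((u + u ^ 3) * q + 8 * \<delta>) / 2)"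
    by (rule bounds(3)[OF S g])
  \<comment> \<open>Half of 8 + 22 gives 15; the total excess
    \<open>\<beta> + 15 * \<delta> - 15 * (\<beta> * \<delta>)\<close> lies within the claimed
    one.\<close>
  moreover have "(1 - \<beta>) * (((u + u ^ 3) * q + 8 * \<delta>) / 2)
      = (1 - \<beta>) * (((u + u ^ 3) * q - 22 * \<delta>) / 2) + 15 * \<delta> - 15 * (\<beta> * \<delta>)"
    by (simp add: field_simps)
  moreover have "0 \<le> \<beta> * \<delta>" using nonneg by simp
  ultimately show ?thesis using nonneg by linarith
qed

theorem theorem4p5:
  fixes X :: "'x measure" and R :: "'r measure"
    and M :: "(nat \<Rightarrow> 'x \<times> nat) \<Rightarrow> 'r measure"
    and n :: nat and \<beta> \<epsilon> \<delta> :: real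
  assumes "\<beta> < 1 / (2 * exp 1)" and "\<epsilon> \<le> ln 2"
    and "M \<in> mechanisms n (labeled X) R"
    and "perfectly_generalizing n (labeled X) R \<beta> \<epsilon> \<delta> M"
  shows "differentially_private n (labeled X) R (4 * \<epsilon>) (16 * \<delta> + 2 * \<beta>)
           (resample n (labeled X) M)"
proof -
  \<comment> \<open>Symmetry yields the second inequality of closeness from the first.\<close>
  have "neighboring n S' S" if "neighboring n S S'" for S S' :: "nat \<Rightarrow> 'x \<times> nat"
    using that unfolding neighboring_def by metis
  then show ?thesis
    using resample_neighboring_le[OF assms]
    unfolding differentially_private_def dist_close_def by blast
qed

end
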